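(* Let $N\in\mathbb{N}$ and let real coefficients $\gamma_1,\gamma_2,\ldots,\gamma_N$ satisfy $$\Big|\sum_{n=K}^N \gamma_n\Big|<1\quad\text{for each } K=1,2,\ldots,N.$$ Then in the limit of large positive $E$ the stationary system $$E w_n = w_{n+1}+w_{n-1}+i\gamma_n w_n+|w_n|^2 w_n,\quad 1\le n\le N,\qquad w_0=\bar w_1,\quad w_{N+1}=0,$$ admits $2^N$ solutions (distinct up to a gauge transformation) such that, for sufficiently large $E$, the map $E\mapsto \mathbf{w}$ is $C^\infty$ at each of these solutions and there is a positive $E$-independent constant $C$ with $$\big||w_n|^2-E\big|\le C\quad\text{for each } n=1,2,\ldots,N.$$ That is, there exist $E_0>0$, $C>0$ and $2^N$ $C^\infty$ maps $E\mapsto\mathbf{w}(E)\in\mathbb{C}^N$ on $(E_0,\infty)$ whose values solve the system and satisfy the bound, with different maps giving solutions that are not gauge-equivalent.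
   Context: Here $E$ is a real parameter and the unknown is $(w_1,\ldots,w_N)\in\mathbb{C}^N$. Extending by $w_{1-n}=\bar w_n$ for $1\le n\le N$, solutions correspond to the $\mathcal{PT}$-invariant vectors $\mathbf{w}=(w_{1-N},\ldots,w_N)^T$ (i.e. $\mathbf{w}=\mathcal{P}\bar{\mathbf{w}}$, where $\mathcal{P}$ reverses the order of components) that give standing waves $\mathbf{q}(t)=\mathbf{w}e^{-iEt}$ of a $\mathcal{PT}$-symmetric discrete nonlinear Schrödinger network with $2N$ sites. The gauge transformation preserving $\mathcal{PT}$-invariance is $\mathbf{w}\mapsto-\mathbf{w}$; two solutions are gauge-equivalent if they are equal or differ by this sign. *)

theory Defs
  imports "HOL-Analysis.Analysis"
begin

text \<open>
  A vector of \<open>\<complex>\<^sup>N\<close> is represented by a function \<open>w :: nat \<Rightarrow> complex\<close>, of which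
  \<open>w 1, \<dots>, w N\<close> are the unknowns. The values \<open>w 0\<close> and \<open>w (N + 1)\<close> are determined by
  the boundary conditions, and all other values are irrelevant.
\<close>

definition stationary_solution ::
    "nat \<Rightarrow> (nat \<Rightarrow> real) \<Rightarrow> real \<Rightarrow> (nat \<Rightarrow> complex) \<Rightarrow> bool" where
  "stationary_solution N \<gamma> E w \<longleftrightarrow>
     w 0 = cnj (w 1) \<and> w (N + 1) = 0 \<and>
     (\<forall>n\<in>{1..N}. of_real E * w n =
        w (n + 1) + w (n - 1) + \<i> * of_real (\<gamma> n) * w n + of_real ((cmod (w n))\<^sup>2) * w n)"

text \<open>
  The only gauge transformation preserving \<open>\<P>\<T>\<close>-invariance, besides the identity,
  is the change of sign.
\<close>

definition gauge_equivalent :: "nat \<Rightarrow> (nat \<Rightarrow> complex) \<Rightarrow> (nat \<Rightarrow> complex) \<Rightarrow> bool" where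
  "gauge_equivalent N v w \<longleftrightarrow> (\<forall>n\<in>{1..N}. v n = w n) \<or> (\<forall>n\<in>{1..N}. v n = - w n)"

text \<open>
  A function of a real variable is \<open>C\<^sup>\<infinity>\<close> on the open set \<open>S\<close> iff all its iterated
  derivatives exist at every point of \<open>S\<close>. Since \<open>S\<close> is open, the derivatives at points of
  \<open>S\<close> depend only on the values of the function on \<open>S\<close>, and continuity of each derivative
  follows from the existence of the next one.
\<close>

definition smooth_on_open :: "real set \<Rightarrow> (real \<Rightarrow> 'a::real_normed_vector) \<Rightarrow> bool" where
  "smooth_on_open S f \<longleftrightarrow> open S \<and>
     (\<forall>k. \<forall>x\<in>S. ((\<lambda>g y. vector_derivative g (at y)) ^^ k) f differentiable (at x))"

end

theory Submission
  imports Defs "HOL-Complex_Analysis.Cauchy_Integral_Formula"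
begin

text \<open>
  Let \<open>q\<^sub>n = cnj (w\<^sub>n\<^sub>-\<^sub>1) w\<^sub>n\<close>. Multiplying the \<open>n\<close>-th equation by \<open>cnj w\<^sub>n\<close>, its imaginary part
  telescopes to \<open>Im q\<^sub>n = (\<Sum>k=n..N. \<gamma>\<^sub>k \<bar>w\<^sub>k\<bar>\<^sup>2)\<close>, so up to a sign \<open>\<sigma>\<^sub>n\<close> the real part of \<open>q\<^sub>n\<close> is the
  square root of \<open>\<bar>w\<^sub>n\<^sub>-\<^sub>1\<bar>\<^sup>2 \<bar>w\<^sub>n\<bar>\<^sup>2 - (Im q\<^sub>n)\<^sup>2\<close>. The real parts of the equations thus become a closed
  system for the densities alone, which in terms of \<open>z\<^sub>n = \<bar>w\<^sub>n\<bar>\<^sup>2 / E - 1\<close> reads \<open>z = \<Phi> z / E\<close>. By the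
  hypothesis on the partial sums the radicands stay away from \<open>0\<close> for small \<open>z\<close>, so \<open>\<Phi>\<close> is bounded and
  Lipschitz there, and \<open>\<Phi> / E\<close> is a contraction for large \<open>E\<close>. This remains true for complex \<open>E\<close> with
  large real part; the iterates starting at \<open>0\<close> are holomorphic in \<open>E\<close> and converge uniformly, so
  the fixed point is holomorphic, whence smoothness on the real axis. The phases are recovered
  from \<open>w\<^sub>1\<^sup>2 = q\<^sub>1\<close> and \<open>w\<^sub>n\<^sub>+\<^sub>1 = q\<^sub>n\<^sub>+\<^sub>1 w\<^sub>n / \<bar>w\<^sub>n\<bar>\<^sup>2\<close>. Since the \<open>q\<^sub>n\<close> are gauge invariant, the
  \<open>2\<^sup>N\<close> choices of signs give inequivalent solutions.
\<close>

section \<open>Holomorphic dependence on the parameter\<close>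

lemma smooth_on_open_subset:
  "smooth_on_open S f \<Longrightarrow> open T \<Longrightarrow> T \<subseteq> S \<Longrightarrow> smooth_on_open T f"
  unfolding smooth_on_open_def by blast

text \<open>Restricting a complex derivative to the real axis gives a vector derivative, so the
  iterated derivatives of \<open>f\<close> on \<open>S\<close> are the restrictions of
  \<open>(deriv ^^ k) F\<close>, which exist to every order. Openness of \<open>S\<close> makes the
  values of \<open>f\<close> elsewhere irrelevant.\<close>

lemma smooth_on_open_holomorphic:
  fixes f :: "real \<Rightarrow> complex"
  assumes F: "F holomorphic_on A" and A: "open A" and S: "open S"
    and SA: "\<And>x. x \<in> S \<Longrightarrow> of_real x \<in> A"
    and f: "\<And>x. x \<in> S \<Longrightarrow> f x = F (of_real x)"
  shows "smooth_on_open S f"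
proof -
  \<comment> \<open>Stated conditionally on the formula at order \<open>k\<close>, so that it drives
    the induction for \<open>eq\<close> and then also yields differentiability.\<close>
  have vd: "(((\<lambda>g y. vector_derivative g (at y)) ^^ k) f has_vector_derivative
      (deriv ^^ Suc k) F (of_real x)) (at x)"
    if eq: "\<And>y. y \<in> S \<Longrightarrow> ((\<lambda>g y. vector_derivative g (at y)) ^^ k) f y = (deriv ^^ k) F (of_real y)"
      and x: "x \<in> S" for k x
  proof -
    have "(deriv ^^ k) F holomorphic_on A"
      using F A by (rule holomorphic_higher_deriv)
    then have "((deriv ^^ k) F has_field_derivative deriv ((deriv ^^ k) F) (of_real x)) (at (of_real x))"
      using A SA[OF x] holomorphic_derivI by blast
    then have "((\<lambda>y. (deriv ^^ k) F (of_real y)) has_vector_derivative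
        deriv ((deriv ^^ k) F) (of_real x)) (at x)"
      by (rule has_vector_derivative_real_field)
    then have "(((\<lambda>g y. vector_derivative g (at y)) ^^ k) f has_vector_derivative
        deriv ((deriv ^^ k) F) (of_real x)) (at x)"
      by (rule has_vector_derivative_transform_within_open[OF _ S x]) (simp add: eq)
    then show ?thesis by simp
  qed
  have eq: "((\<lambda>g y. vector_derivative g (at y)) ^^ k) f x = (deriv ^^ k) F (of_real x)"
    if "x \<in> S" for k x
    using that
  proof (induction k arbitrary: x)
    case (Suc k)
    then show ?case using vector_derivative_at[OF vd[OF Suc.IH Suc.prems]] by simp
  qed (simp add: f)
  show ?thesis
    unfolding smooth_on_open_def
    using S vd[OF eq] by (blast intro: differentiableI_vector)
qed

text \<open>Iterating from \<open>0\<close> converges geometrically at a rate independent of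
  \<open>E\<close>, so the limit is holomorphic by Weierstrass; it is real for real \<open>E\<close>
  because the iterates are and the reals are closed. The condition \<open>hol\<close> speaks of
  holomorphic families \<open>z m\<close>, so that only functions of one complex variable
  occur.\<close>

lemma holomorphic_contraction_fixpoint:
  fixes F :: "complex \<Rightarrow> ('i \<Rightarrow> complex) \<Rightarrow> 'i \<Rightarrow> complex"
  assumes A: "open A" and I: "finite I" and \<delta>: "0 \<le> \<delta>"
    and self: "\<And>E z n. E \<in> A \<Longrightarrow> (\<And>m. m \<in> I \<Longrightarrow> norm (z m) \<le> \<delta>) \<Longrightarrow> n \<in> I \<Longrightarrow> norm (F E z n) \<le> \<delta>"
    and contr: "\<And>E z z'. E \<in> A \<Longrightarrow> (\<And>m. m \<in> I \<Longrightarrow> norm (z m) \<le> \<delta>) \<Longrightarrow> (\<And>m. m \<in> I \<Longrightarrow> norm (z' m) \<le> \<delta>) \<Longrightarrow>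
      (\<Sum>n\<in>I. norm (F E z n - F E z' n)) \<le> 1/2 * (\<Sum>n\<in>I. norm (z n - z' n))"
    and hol: "\<And>z n. (\<And>m. m \<in> I \<Longrightarrow> z m holomorphic_on A) \<Longrightarrow>
      (\<And>m E. m \<in> I \<Longrightarrow> E \<in> A \<Longrightarrow> norm (z m E) \<le> \<delta>) \<Longrightarrow> n \<in> I \<Longrightarrow>
      (\<lambda>E. F E (\<lambda>m. z m E) n) holomorphic_on A"
    and real: "\<And>E z n. E \<in> A \<Longrightarrow> E \<in> \<real> \<Longrightarrow> (\<And>m. m \<in> I \<Longrightarrow> norm (z m) \<le> \<delta>) \<Longrightarrow>
      (\<And>m. m \<in> I \<Longrightarrow> z m \<in> \<real>) \<Longrightarrow> n \<in> I \<Longrightarrow> F E z n \<in> \<real>"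
  obtains Z where "\<And>n. n \<in> I \<Longrightarrow> Z n holomorphic_on A"
    and "\<And>n E. n \<in> I \<Longrightarrow> E \<in> A \<Longrightarrow> norm (Z n E) \<le> \<delta>"
    and "\<And>n E. n \<in> I \<Longrightarrow> E \<in> A \<Longrightarrow> Z n E = F E (\<lambda>m. Z m E) n"
    and "\<And>n E. n \<in> I \<Longrightarrow> E \<in> A \<Longrightarrow> E \<in> \<real> \<Longrightarrow> Z n E \<in> \<real>"
proof -
  define zk where "zk k E = ((F E) ^^ k) (\<lambda>_. 0)" for k E
  have zk0: "zk 0 E n = 0" and zkS: "zk (Suc k) E = F E (zk k E)" for k E n
    by (simp_all add: zk_def)
  have bd: "norm (zk k E n) \<le> \<delta>" if "n \<in> I" "E \<in> A" for k n E
    using that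
  proof (induction k arbitrary: n)
    case (Suc k)
    then show ?case unfolding zkS by (intro self) auto
  qed (use \<delta> in \<open>simp add: zk0\<close>)
  have re: "zk k E n \<in> \<real>" if "n \<in> I" "E \<in> A" "E \<in> \<real>" for k n E
    using that
  proof (induction k arbitrary: n)
    case (Suc k)
    then show ?case unfolding zkS using bd by (intro real) auto
  qed (simp add: zk0)
  have ho: "(\<lambda>E. zk k E n) holomorphic_on A" if "n \<in> I" for k n
    using that
  proof (induction k arbitrary: n)
    case (Suc k)
    then show ?case unfolding zkS using hol[of "\<lambda>m E. zk k E m"] bd by blast
  qed (simp add: zk0)
  \<comment> \<open>The iteration starts at \<open>0\<close>, so its first increment is at most
    \<open>\<delta>\<close> in each coordinate. This bound is the same for all \<open>E\<close> in
    \<open>A\<close>.\<close>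
  define D where "D = (\<Sum>n\<in>I. \<delta>)"
  have step: "(\<Sum>n\<in>I. norm (zk (Suc k) E n - zk k E n)) \<le> (1/2)^k * D" if "E \<in> A" for k E
  proof (induction k)
    case 0
    have "(\<Sum>n\<in>I. norm (zk (Suc 0) E n - zk 0 E n)) \<le> D"
      unfolding D_def using bd that by (intro sum_mono) (simp add: zk0)
    then show ?case by simp
  next
    case (Suc k)
    have "(\<Sum>n\<in>I. norm (zk (Suc (Suc k)) E n - zk (Suc k) E n))
        = (\<Sum>n\<in>I. norm (F E (zk (Suc k) E) n - F E (zk k E) n))"
      by (simp add: zkS)
    also have "\<dots> \<le> 1/2 * (\<Sum>n\<in>I. norm (zk (Suc k) E n - zk k E n))"
      using contr[OF that] bd that by simp
    also have "\<dots> \<le> (1/2)^Suc k * D"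
      using Suc by simp
    finally show ?case .
  qed
  \<comment> \<open>The limit is written as a telescoping series so that the M-test gives uniform
    convergence.\<close>
  define Z where "Z n E = (\<Sum>k. zk (Suc k) E n - zk k E n)" for n E
  have ul: "uniform_limit A (\<lambda>k E. zk k E n) (Z n) sequentially" if n: "n \<in> I" for n
  proof -
    have "norm (zk (Suc k) E n - zk k E n) \<le> (1/2)^k * D" if "E \<in> A" for k E
      using step[OF that, of k] member_le_sum[of n I "\<lambda>n. norm (zk (Suc k) E n - zk k E n)"] n I
      by auto
    moreover have "summable (\<lambda>k. (1/2)^k * D)"
      by (intro summable_mult2 summable_geometric) simp
    ultimately have "uniform_limit A (\<lambda>k E. \<Sum>i<k. zk (Suc i) E n - zk i E n) (Z n) sequentially"
      unfolding Z_def by (rule Weierstrass_m_test)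
    moreover have "(\<Sum>i<k. zk (Suc i) E n - zk i E n) = zk k E n" for k E
      using sum_lessThan_telescope[of "\<lambda>k. zk k E n" k] by (simp add: zk0)
    ultimately show ?thesis by simp
  qed
  have lim: "(\<lambda>k. zk k E n) \<longlonglongrightarrow> Z n E" if "n \<in> I" "E \<in> A" for n E
    using tendsto_uniform_limitI[OF ul] that by blast
  have Zbd: "norm (Z n E) \<le> \<delta>" if "n \<in> I" "E \<in> A" for n E
    using lim[OF that] bd[OF that] by (intro LIMSEQ_le_const2[OF tendsto_norm]) auto
  have fixp: "Z n E = F E (\<lambda>m. Z m E) n" if n: "n \<in> I" and E: "E \<in> A" for n E
  proof -
    have "(\<lambda>k. 1/2 * (\<Sum>m\<in>I. norm (zk k E m - Z m E))) \<longlonglongrightarrow> 1/2 * (\<Sum>m\<in>I. norm (Z m E - Z m E))"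
      using lim E by (intro tendsto_intros) auto
    then have "(\<lambda>k. 1/2 * (\<Sum>m\<in>I. norm (zk k E m - Z m E))) \<longlonglongrightarrow> 0"
      by simp
    \<comment> \<open>The contraction estimate supplies the continuity in \<open>z\<close> that is
      needed to pass to the limit inside \<open>F E\<close>.\<close>
    moreover have le: "norm (zk (Suc k) E n - F E (\<lambda>m. Z m E) n) \<le> 1/2 * (\<Sum>m\<in>I. norm (zk k E m - Z m E))" for k
      using contr[OF E, of "zk k E" "\<lambda>m. Z m E"] bd Zbd E n I
        member_le_sum[of n I "\<lambda>n. norm (F E (zk k E) n - F E (\<lambda>m. Z m E) n)"]
      by (force simp: zkS)
    ultimately have "(\<lambda>k. zk (Suc k) E n - F E (\<lambda>m. Z m E) n) \<longlonglongrightarrow> 0"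
      by (intro Lim_null_comparison[OF always_eventually[OF allI[OF le]]])
    then have "(\<lambda>k. zk (Suc k) E n) \<longlonglongrightarrow> F E (\<lambda>m. Z m E) n"
      by (simp add: LIM_zero_iff)
    moreover have "(\<lambda>k. zk (Suc k) E n) \<longlonglongrightarrow> Z n E"
      using lim[OF n E] by (rule LIMSEQ_Suc)
    ultimately show ?thesis by (metis LIMSEQ_unique)
  qed
  have Zre: "Z n E \<in> \<real>" if "n \<in> I" "E \<in> A" "E \<in> \<real>" for n E
    using closed_sequentially[OF closed_complex_Reals re[OF that] lim[OF that(1,2)]] .
  have Zho: "Z n holomorphic_on A" if n: "n \<in> I" for n
  proof (rule holomorphic_uniform_sequence[OF A])
    fix k show "(\<lambda>E. zk k E n) holomorphic_on A" using ho[OF n] .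
  next
    fix E assume "E \<in> A"
    then obtain d where "d > 0" "cball E d \<subseteq> A"
      using A open_contains_cball by blast
    then show "\<exists>d>0. cball E d \<subseteq> A \<and> uniform_limit (cball E d) (\<lambda>k E. zk k E n) (Z n) sequentially"
      using uniform_limit_on_subset[OF ul[OF n]] by blast
  qed
  show thesis using that[of Z] Zho Zbd fixp Zre by blast
qed

section \<open>Bounded Lipschitz functions\<close>

text \<open>Boundedness is bundled in because the Lipschitz constant of a product involves bounds of
  the factors. The distance \<open>d\<close> is a parameter: it will be \<open>l1_dist\<close>,
  which sees only the coordinates \<open>1..N\<close> and hence does not separate all
  functions.\<close>

definition bounded_lipschitz :: "('a \<Rightarrow> 'a \<Rightarrow> real) \<Rightarrow> 'a set \<Rightarrow> ('a \<Rightarrow> complex) \<Rightarrow> bool" where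
  "bounded_lipschitz d D f \<longleftrightarrow> (\<exists>B. \<forall>z\<in>D. norm (f z) \<le> B) \<and>
     (\<exists>K. \<forall>z\<in>D. \<forall>z'\<in>D. norm (f z - f z') \<le> K * d z z')"

lemma bounded_lipschitzI:
  assumes "\<And>z. z \<in> D \<Longrightarrow> norm (f z) \<le> B"
    and "\<And>z z'. z \<in> D \<Longrightarrow> z' \<in> D \<Longrightarrow> norm (f z - f z') \<le> K * d z z'"
  shows "bounded_lipschitz d D f"
  using assms unfolding bounded_lipschitz_def by blast

lemma bounded_lipschitzE:
  assumes "bounded_lipschitz d D f"
  obtains B K where "\<And>z. z \<in> D \<Longrightarrow> norm (f z) \<le> B"
    and "\<And>z z'. z \<in> D \<Longrightarrow> z' \<in> D \<Longrightarrow> norm (f z - f z') \<le> K * d z z'"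
  using assms unfolding bounded_lipschitz_def by blast

lemma bounded_lipschitz_const: "bounded_lipschitz d D (\<lambda>_. c)"
  by (rule bounded_lipschitzI[where B="norm c" and K=0]) auto

lemma bounded_lipschitz_minus:
  assumes "bounded_lipschitz d D f"
  shows "bounded_lipschitz d D (\<lambda>z. - f z)"
proof -
  have "norm (- a - - b) = norm (a - b)" for a b :: complex
    by (metis minus_diff_minus norm_minus_cancel)
  then show ?thesis using assms unfolding bounded_lipschitz_def by simp
qed

lemma bounded_lipschitz_add:
  assumes "bounded_lipschitz d D f" "bounded_lipschitz d D g"
  shows "bounded_lipschitz d D (\<lambda>z. f z + g z)"
proof -
  obtain B K where f: "\<And>z. z \<in> D \<Longrightarrow> norm (f z) \<le> B"
    "\<And>z z'. z \<in> D \<Longrightarrow> z' \<in> D \<Longrightarrow> norm (f z - f z') \<le> K * d z z'"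
    using bounded_lipschitzE[OF assms(1)] by metis
  obtain B' K' where g: "\<And>z. z \<in> D \<Longrightarrow> norm (g z) \<le> B'"
    "\<And>z z'. z \<in> D \<Longrightarrow> z' \<in> D \<Longrightarrow> norm (g z - g z') \<le> K' * d z z'"
    using bounded_lipschitzE[OF assms(2)] by metis
  show ?thesis
  proof (rule bounded_lipschitzI[where B="B + B'" and K="K + K'"])
    fix z assume z: "z \<in> D"
    show "norm (f z + g z) \<le> B + B'"
      using norm_triangle_ineq[of "f z" "g z"] f(1)[OF z] g(1)[OF z] by linarith
    fix z' assume z': "z' \<in> D"
    show "norm (f z + g z - (f z' + g z')) \<le> (K + K') * d z z'"
      using norm_diff_triangle_ineq[of "f z" "g z" "f z'" "g z'"] f(2)[OF z z'] g(2)[OF z z']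
      by (simp add: distrib_right)
  qed
qed

lemma bounded_lipschitz_mult:
  assumes "bounded_lipschitz d D f" "bounded_lipschitz d D g"
  shows "bounded_lipschitz d D (\<lambda>z. f z * g z)"
proof -
  obtain B K where f: "\<And>z. z \<in> D \<Longrightarrow> norm (f z) \<le> B"
    "\<And>z z'. z \<in> D \<Longrightarrow> z' \<in> D \<Longrightarrow> norm (f z - f z') \<le> K * d z z'"
    using bounded_lipschitzE[OF assms(1)] by metis
  obtain B' K' where g: "\<And>z. z \<in> D \<Longrightarrow> norm (g z) \<le> B'"
    "\<And>z z'. z \<in> D \<Longrightarrow> z' \<in> D \<Longrightarrow> norm (g z - g z') \<le> K' * d z z'"
    using bounded_lipschitzE[OF assms(2)] by metis
  show ?thesis
  proof (rule bounded_lipschitzI[where B="B * B'" and K="B * K' + B' * K"])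
    fix z assume z: "z \<in> D"
    have B: "0 \<le> B" using f(1)[OF z] norm_ge_zero order_trans by blast
    show "norm (f z * g z) \<le> B * B'"
      unfolding norm_mult using f(1)[OF z] g(1)[OF z] B by (intro mult_mono) auto
    fix z' assume z': "z' \<in> D"
    have "f z * g z - f z' * g z' = f z * (g z - g z') + g z' * (f z - f z')"
      by (simp add: algebra_simps)
    also have "norm \<dots> \<le> norm (f z) * norm (g z - g z') + norm (g z') * norm (f z - f z')"
      by (rule norm_triangle_le) (simp add: norm_mult)
    also have "\<dots> \<le> B * (K' * d z z') + B' * (K * d z z')"
      using f(1)[OF z] g(1)[OF z'] f(2)[OF z z'] g(2)[OF z z'] B
      by (intro add_mono mult_mono) (auto intro: order_trans[OF norm_ge_zero])
    finally show "norm (f z * g z - f z' * g z') \<le> (B * K' + B' * K) * d z z'"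
      by (simp add: algebra_simps)
  qed
qed

lemma bounded_lipschitz_sum:
  assumes "\<And>i. i \<in> I \<Longrightarrow> bounded_lipschitz d D (f i)"
  shows "bounded_lipschitz d D (\<lambda>z. \<Sum>i\<in>I. f i z)"
  using assms
  by (induction I rule: infinite_finite_induct)
    (auto intro: bounded_lipschitz_const bounded_lipschitz_add)

lemma bounded_lipschitz_inverse:
  assumes f: "bounded_lipschitz d D f" and c: "c > 0" "\<And>z. z \<in> D \<Longrightarrow> c \<le> norm (f z)"
  shows "bounded_lipschitz d D (\<lambda>z. inverse (f z))"
proof -
  obtain K where K: "\<And>z z'. z \<in> D \<Longrightarrow> z' \<in> D \<Longrightarrow> norm (f z - f z') \<le> K * d z z'"
    using bounded_lipschitzE[OF f] by metis
  show ?thesis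
  proof (rule bounded_lipschitzI[where B="inverse c" and K="inverse c * inverse c * K"])
    fix z assume z: "z \<in> D"
    have i: "norm (inverse (f z)) \<le> inverse c" if "z \<in> D" for z
      unfolding norm_inverse using c(1) c(2)[OF that] by (rule le_imp_inverse_le[rotated])
    show "norm (inverse (f z)) \<le> inverse c" using i z .
    fix z' assume z': "z' \<in> D"
    have "f z \<noteq> 0" "f z' \<noteq> 0" using c(1) c(2)[OF z] c(2)[OF z'] by auto
    then have "norm (inverse (f z) - inverse (f z'))
        = norm (inverse (f z)) * norm (inverse (f z')) * norm (f z - f z')"
      by (simp add: inverse_diff_inverse norm_mult)
    also have "\<dots> \<le> inverse c * inverse c * (K * d z z')"
      using i[OF z] i[OF z'] K[OF z z'] c(1) by (intro mult_mono) auto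
    finally show "norm (inverse (f z) - inverse (f z')) \<le> inverse c * inverse c * K * d z z'"
      by simp
  qed
qed

lemma Re_csqrt_ge:
  assumes "c \<le> Re a"
  shows "sqrt c \<le> Re (csqrt a)"
proof -
  have "Re a \<le> cmod a" by (rule complex_Re_le_cmod)
  then show ?thesis using assms by simp
qed

text \<open>The difference of two roots is the difference of the radicands divided by the sum of the
  roots. Both roots have real part at least \<open>sqrt c\<close>, so this sum stays away from
  \<open>0\<close>.\<close>

lemma bounded_lipschitz_csqrt:
  assumes f: "bounded_lipschitz d D f" and c: "c > 0" "\<And>z. z \<in> D \<Longrightarrow> c \<le> Re (f z)"
  shows "bounded_lipschitz d D (\<lambda>z. csqrt (f z))"
proof -
  obtain B K where B: "\<And>z. z \<in> D \<Longrightarrow> norm (f z) \<le> B"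
    and K: "\<And>z z'. z \<in> D \<Longrightarrow> z' \<in> D \<Longrightarrow> norm (f z - f z') \<le> K * d z z'"
    using bounded_lipschitzE[OF f] by metis
  show ?thesis
  proof (rule bounded_lipschitzI[where B="sqrt B" and K="inverse (sqrt c) * K"])
    fix z assume z: "z \<in> D"
    show "norm (csqrt (f z)) \<le> sqrt B" using B[OF z] by simp
    fix z' assume z': "z' \<in> D"
    have s: "sqrt c > 0" using c(1) by simp
    have "sqrt c \<le> Re (csqrt (f z) + csqrt (f z'))"
      using Re_csqrt_ge[OF c(2)[OF z]] Re_csqrt_ge[OF c(2)[OF z']] s
      unfolding plus_complex.sel by linarith
    then have n: "sqrt c \<le> norm (csqrt (f z) + csqrt (f z'))"
      using complex_Re_le_cmod order_trans by blast
    have "f z - f z' = (csqrt (f z) - csqrt (f z')) * (csqrt (f z) + csqrt (f z'))"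
      by (simp add: algebra_simps flip: power2_eq_square)
    then have "norm (f z - f z') = norm (csqrt (f z) - csqrt (f z')) * norm (csqrt (f z) + csqrt (f z'))"
      by (simp add: norm_mult)
    then have "norm (csqrt (f z) - csqrt (f z')) * sqrt c \<le> norm (f z - f z')"
      using n by (simp add: mult_left_mono)
    also have "\<dots> \<le> K * d z z'" using K[OF z z'] .
    finally show "norm (csqrt (f z) - csqrt (f z')) \<le> inverse (sqrt c) * K * d z z'"
      using s by (simp add: field_simps)
  qed
qed

section \<open>The reduction to densities\<close>

text \<open>Here \<open>u\<close> stands for \<open>w / sqrt E\<close>, \<open>y\<close> for its
  densities and \<open>Complex (s n) (j n)\<close> for its links. The recursions for
  \<open>s\<close> and \<open>j\<close> are the real and imaginary parts of the equation multiplied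
  by \<open>cnj (u n)\<close>, which can be cancelled since \<open>y n > 0\<close>.\<close>

lemma stationary_solution_from_links:
  fixes y s j :: "nat \<Rightarrow> real" and u :: "nat \<Rightarrow> complex"
  assumes E: "E > 0" and N: "N \<ge> 1"
    and y: "\<And>n. n \<in> {1..N} \<Longrightarrow> y n > 0" and y0: "y 0 = y 1"
    and q: "\<And>n. n \<in> {1..N} \<Longrightarrow> (s n)\<^sup>2 + (j n)\<^sup>2 = y (n - 1) * y n"
    and bd: "s (N + 1) = 0" "j (N + 1) = 0"
    and j: "\<And>n. n \<in> {1..N} \<Longrightarrow> j n = j (n + 1) + \<gamma> n * y n"
    and s: "\<And>n. n \<in> {1..N} \<Longrightarrow> E * (1 - y n) * y n = s (n + 1) + s n"
    and u0: "u 0 = cnj (u 1)" and u1: "(u 1)\<^sup>2 = Complex (s 1) (j 1)"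
    and u: "\<And>n. n \<in> {1..N} \<Longrightarrow> u (n + 1) = Complex (s (n + 1)) (j (n + 1)) * u n / y n"
  shows "stationary_solution N \<gamma> E (\<lambda>n. sqrt E * u n)"
    and "\<And>n. n \<in> {1..N} \<Longrightarrow> (norm (u n))\<^sup>2 = y n"
    and "\<And>n. n \<in> {1..N} \<Longrightarrow> cnj (u (n - 1)) * u n = Complex (s n) (j n)"
proof -
  have norm_u: "(norm (u n))\<^sup>2 = y n" if "n \<in> {1..N}" for n
    using that
  proof (induction n)
    case (Suc n)
    show ?case
    proof (cases "n = 0")
      case True
      \<comment> \<open>At the first site \<open>y 0 = y 1\<close> turns \<open>q\<close> into an
        identity between squares; the later densities follow from the recursion for
        \<open>u\<close>.\<close>
      have "((norm (u 1))\<^sup>2)\<^sup>2 = (norm (Complex (s 1) (j 1)))\<^sup>2"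
        using u1 by (metis norm_power)
      also have "\<dots> = (y 1)\<^sup>2"
        using q[of 1] N y0 unfolding cmod_power2 by (simp add: power2_eq_square)
      finally have "(norm (u 1))\<^sup>2 = y 1"
        using y[of 1] N by (intro power2_eq_imp_eq[of "(norm (u 1))\<^sup>2"]) auto
      then show ?thesis using True by simp
    next
      case False
      then have n: "n \<in> {1..N}" using Suc.prems by simp
      have "(norm (u (n + 1)))\<^sup>2 = ((s (n + 1))\<^sup>2 + (j (n + 1))\<^sup>2) * (norm (u n))\<^sup>2 / (y n)\<^sup>2"
        unfolding u[OF n] by (simp add: norm_mult norm_divide power_mult_distrib power_divide cmod_power2)
      also have "\<dots> = y (n + 1)"
        using q[OF Suc.prems] Suc.IH[OF n] y[OF n] by (simp add: power2_eq_square)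
      finally show ?thesis by simp
    qed
  qed simp
  then show "(norm (u n))\<^sup>2 = y n" if "n \<in> {1..N}" for n
    using that .
  have uu: "cnj (u n) * u n = y n" if "n \<in> {1..N}" for n
    using norm_u[OF that] by (metis complex_norm_square mult.commute)
  have next_link: "cnj (u n) * u (n + 1) = Complex (s (n + 1)) (j (n + 1))" if n: "n \<in> {1..N}" for n
  proof -
    have "cnj (u n) * u (n + 1) = Complex (s (n + 1)) (j (n + 1)) * (cnj (u n) * u n) / y n"
      unfolding u[OF n] by simp
    then show ?thesis unfolding uu[OF n] using y[OF n] by simp
  qed
  have link: "cnj (u (n - 1)) * u n = Complex (s n) (j n)" if n: "n \<in> {1..N}" for n
  proof (cases "n = 1")
    case True
    then show ?thesis using u0 u1 by (simp add: power2_eq_square)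
  next
    case False
    then obtain m where "n = m + 1" "m \<in> {1..N}"
      using n by (metis Suc_eq_plus1 Suc_leD Suc_le_eq atLeastAtMost_iff le_neq_implies_less less_Suc_eq_le
          not0_implies_Suc not_one_le_zero One_nat_def)
    then show ?thesis using next_link[of m] by simp
  qed
  then show "cnj (u (n - 1)) * u n = Complex (s n) (j n)" if "n \<in> {1..N}" for n
    using that .
  have eq: "of_real E * u n = u (n + 1) + u (n - 1) + \<i> * of_real (\<gamma> n) * u n
      + of_real (E * y n) * u n" if n: "n \<in> {1..N}" for n
  proof -
    have "cnj (cnj (u (n - 1)) * u n) = cnj (u n) * u (n - 1)"
      by simp
    then have prev: "cnj (u n) * u (n - 1) = Complex (s n) (- j n)"
      unfolding link[OF n] by (simp add: complex_eq_iff)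
    have "cnj (u n) * (of_real E * u n - (u (n + 1) + u (n - 1) + \<i> * of_real (\<gamma> n) * u n
        + of_real (E * y n) * u n)) =
      (of_real E - \<i> * of_real (\<gamma> n) - of_real (E * y n)) * (cnj (u n) * u n)
        - cnj (u n) * u (n + 1) - cnj (u n) * u (n - 1)"
      by (simp add: algebra_simps)
    also have "\<dots> = 0"
    proof -
      have "(E - E * y n) * y n = E * (1 - y n) * y n"
        by (simp add: algebra_simps)
      also note s[OF n]
      finally have "(E - E * y n) * y n = s (n + 1) + s n" .
      then show ?thesis
        unfolding uu[OF n] next_link[OF n] prev
        using j[OF n] by (intro complex_eqI) simp_all
    qed
    finally show ?thesis
      using norm_u[OF n] y[OF n] by auto
  qed
  show "stationary_solution N \<gamma> E (\<lambda>n. sqrt E * u n)"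
    unfolding stationary_solution_def
  proof (intro conjI ballI)
    show "of_real (sqrt E) * u 0 = cnj (of_real (sqrt E) * u 1)"
      using u0 by simp
    \<comment> \<open>The link at \<open>N + 1\<close> vanishes by \<open>bd\<close>, and the
      recursion multiplies by it.\<close>
    show "of_real (sqrt E) * u (N + 1) = 0"
      using u[of N] bd N by (simp add: complex_eq_iff)
    fix n assume n: "n \<in> {1..N}"
    have "(cmod (of_real (sqrt E) * u n))\<^sup>2 = E * y n"
      using E norm_u[OF n] by (simp add: norm_mult power_mult_distrib)
    moreover have "of_real E * (of_real (sqrt E) * u n) = of_real (sqrt E) * (of_real E * u n)"
      by simp
    ultimately show "of_real E * (of_real (sqrt E) * u n) = of_real (sqrt E) * u (n + 1)
        + of_real (sqrt E) * u (n - 1) + \<i> * of_real (\<gamma> n) * (of_real (sqrt E) * u n)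
        + of_real ((cmod (of_real (sqrt E) * u n))\<^sup>2) * (of_real (sqrt E) * u n)"
      unfolding eq[OF n] by (simp add: algebra_simps)
  qed
qed

text \<open>
  The densities of a solution are written as \<open>\<bar>w\<^sub>n\<bar>\<^sup>2 = E (1 + z\<^sub>n)\<close>. The index \<open>max 1 n\<close>
  encodes the boundary condition at \<open>0\<close>, which forces equal densities at the sites \<open>0\<close> and \<open>1\<close>.
  The link between the sites \<open>n - 1\<close> and \<open>n\<close> is the number \<open>cnj (w\<^sub>n\<^sub>-\<^sub>1) w\<^sub>n / E\<close>; its imaginary
  part is the flux and its real part the coupling, of sign \<open>\<sigma> n\<close>. The definitions are
  polynomial or algebraic in \<open>z\<close>, without conjugates, so that they also make sense for complex \<open>E\<close>.
\<close>

definition site_density :: "(nat \<Rightarrow> complex) \<Rightarrow> nat \<Rightarrow> complex" where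
  "site_density z n = 1 + z (max 1 n)"

definition flux :: "nat \<Rightarrow> (nat \<Rightarrow> real) \<Rightarrow> (nat \<Rightarrow> complex) \<Rightarrow> nat \<Rightarrow> complex" where
  "flux N \<gamma> z n = (\<Sum>k=n..N. of_real (\<gamma> k) * (1 + z k))"

definition coupling ::
    "nat \<Rightarrow> (nat \<Rightarrow> real) \<Rightarrow> (nat \<Rightarrow> real) \<Rightarrow> (nat \<Rightarrow> complex) \<Rightarrow> nat \<Rightarrow> complex" where
  "coupling N \<gamma> \<sigma> z n = (if n \<le> N then
     of_real (\<sigma> n) * csqrt (site_density z (n - 1) * site_density z n - (flux N \<gamma> z n)\<^sup>2) else 0)"

definition link ::
    "nat \<Rightarrow> (nat \<Rightarrow> real) \<Rightarrow> (nat \<Rightarrow> real) \<Rightarrow> (nat \<Rightarrow> complex) \<Rightarrow> nat \<Rightarrow> complex" where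
  "link N \<gamma> \<sigma> z n = coupling N \<gamma> \<sigma> z n + \<i> * flux N \<gamma> z n"

text \<open>With \<open>y = 1 + z n\<close>, the real part
  \<open>E (1 - y) y = s (n + 1) + s n\<close> of the equation becomes
  \<open>z n = density_map N \<gamma> \<sigma> z n / E\<close>. At \<open>n = N\<close> the default
  \<open>0\<close> of \<open>coupling\<close> encodes \<open>w (N + 1) = 0\<close>.\<close>

definition density_map ::
    "nat \<Rightarrow> (nat \<Rightarrow> real) \<Rightarrow> (nat \<Rightarrow> real) \<Rightarrow> (nat \<Rightarrow> complex) \<Rightarrow> nat \<Rightarrow> complex" where
  "density_map N \<gamma> \<sigma> z n =
     - (coupling N \<gamma> \<sigma> z (n + 1) + coupling N \<gamma> \<sigma> z n) * inverse (site_density z n)"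

text \<open>
  \<open>w\<^sub>1\<^sup>2\<close> is \<open>E\<close> times the first link. When its real part is negative, the square root is taken
  with the branch cut along the positive reals.
\<close>

primrec amplitude ::
    "nat \<Rightarrow> (nat \<Rightarrow> real) \<Rightarrow> (nat \<Rightarrow> real) \<Rightarrow> (nat \<Rightarrow> complex) \<Rightarrow> nat \<Rightarrow> complex" where
  "amplitude N \<gamma> \<sigma> z 0 =
     (if \<sigma> 1 = 1 then csqrt (link N \<gamma> \<sigma> z 1) else \<i> * csqrt (- link N \<gamma> \<sigma> z 1))"
| "amplitude N \<gamma> \<sigma> z (Suc m) =
     link N \<gamma> \<sigma> z (m + 2) * amplitude N \<gamma> \<sigma> z m / site_density z (m + 1)"

section \<open>Uniform positivity of the radicands near \<open>z = 0\<close>\<close>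

lemma norm_flux_le:
  assumes z: "\<And>m. m \<in> {1..N} \<Longrightarrow> norm (z m) \<le> \<delta>" and n: "n \<in> {1..N}"
  shows "norm (flux N \<gamma> z n) \<le> \<bar>\<Sum>k=n..N. \<gamma> k\<bar> + \<delta> * (\<Sum>k=1..N. \<bar>\<gamma> k\<bar>)"
proof -
  have \<delta>: "0 \<le> \<delta>" using z[OF n] norm_ge_zero order_trans by blast
  have "norm (\<Sum>k=n..N. of_real (\<gamma> k) * z k) \<le> (\<Sum>k=n..N. \<delta> * \<bar>\<gamma> k\<bar>)"
    using z n by (intro sum_norm_le) (auto simp: norm_mult mult.commute[of \<delta>] intro!: mult_left_mono)
  also have "\<dots> \<le> (\<Sum>k=1..N. \<delta> * \<bar>\<gamma> k\<bar>)"
    using n \<delta> by (intro sum_mono2) auto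
  finally have "norm (\<Sum>k=n..N. of_real (\<gamma> k) * z k) \<le> \<delta> * (\<Sum>k=1..N. \<bar>\<gamma> k\<bar>)"
    by (simp add: sum_distrib_left)
  moreover have split: "flux N \<gamma> z n = of_real (\<Sum>k=n..N. \<gamma> k) + (\<Sum>k=n..N. of_real (\<gamma> k) * z k)"
    by (simp add: flux_def distrib_left sum.distrib)
  moreover have "norm (of_real (\<Sum>k=n..N. \<gamma> k) :: complex) = \<bar>\<Sum>k=n..N. \<gamma> k\<bar>"
    by (rule norm_of_real)
  ultimately show ?thesis
    unfolding split
    using norm_triangle_ineq[of "of_real (\<Sum>k=n..N. \<gamma> k)" "\<Sum>k=n..N. of_real (\<gamma> k) * z k"]
    by linarith
qed

text \<open>At \<open>z = 0\<close> the radicand is one minus the square of a partial sum of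
  \<open>\<gamma>\<close>, positive by hypothesis. Continuity at finitely many sites leaves a common
  \<open>\<delta>\<close>, serving both as radius and as lower bound.\<close>

lemma radicand_bound:
  fixes \<gamma> :: "nat \<Rightarrow> real"
  assumes "\<forall>K\<in>{1..N}. \<bar>\<Sum>n=K..N. \<gamma> n\<bar> < 1"
  obtains \<delta> where "0 < \<delta>" "\<delta> < 1/2"
    and "\<And>z n. (\<And>m. m \<in> {1..N} \<Longrightarrow> norm (z m) \<le> \<delta>) \<Longrightarrow> n \<in> {1..N} \<Longrightarrow>
      \<delta> \<le> Re (site_density z (n - 1) * site_density z n - (flux N \<gamma> z n)\<^sup>2)"
proof -
  define \<Gamma> where "\<Gamma> n = \<bar>\<Sum>k=n..N. \<gamma> k\<bar>" for n
  define G where "G = (\<Sum>k=1..N. \<bar>\<gamma> k\<bar>)"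
  \<comment> \<open>Of the four \<open>\<delta>\<close>, three absorb the deviation of the product
    of two densities from \<open>1\<close>; the fourth is the lower bound to be reached.\<close>
  have "eventually (\<lambda>\<delta>. 0 < 1 - 4 * \<delta> - (\<Gamma> n + \<delta> * G)\<^sup>2) (at_right 0)" if "n \<in> {1..N}" for n
  proof -
    have "((\<lambda>\<delta>. 1 - 4 * \<delta> - (\<Gamma> n + \<delta> * G)\<^sup>2) \<longlongrightarrow> 1 - 4 * 0 - (\<Gamma> n + 0 * G)\<^sup>2) (at_right 0)"
      by (intro tendsto_intros)
    moreover have "(\<Gamma> n)\<^sup>2 < 1"
      using assms that by (simp add: \<Gamma>_def abs_square_less_1)
    ultimately show ?thesis by (intro order_tendstoD(1)) auto
  qed
  then have "eventually (\<lambda>\<delta>. \<forall>n\<in>{1..N}. 0 < 1 - 4 * \<delta> - (\<Gamma> n + \<delta> * G)\<^sup>2) (at_right 0)"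
    by (intro eventually_ball_finite) auto
  moreover have "eventually (\<lambda>\<delta>::real. 0 < \<delta> \<and> \<delta> < 1/2) (at_right 0)"
    by (intro eventually_conj eventually_at_right_less eventually_at_rightI[of 0 "1/2"]) auto
  ultimately obtain \<delta> where \<delta>: "0 < \<delta>" "\<delta> < 1/2"
    and ev: "\<And>n. n \<in> {1..N} \<Longrightarrow> 0 < 1 - 4 * \<delta> - (\<Gamma> n + \<delta> * G)\<^sup>2"
    using eventually_happens[OF eventually_conj] by force
  show thesis
  proof (rule that[OF \<delta>])
    fix z :: "nat \<Rightarrow> complex" and n
    assume z: "\<And>m. m \<in> {1..N} \<Longrightarrow> norm (z m) \<le> \<delta>" and n: "n \<in> {1..N}"
    let ?a = "z (max 1 (n - 1))" and ?b = "z (max 1 n)"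
    have a: "norm ?a \<le> \<delta>" and b: "norm ?b \<le> \<delta>"
      using n by (auto intro!: z)
    have "norm (?a + ?b + ?a * ?b) \<le> norm ?a + norm ?b + norm ?a * norm ?b"
      using norm_triangle_ineq[of "?a + ?b" "?a * ?b"] norm_triangle_ineq[of ?a ?b]
      by (simp add: norm_mult)
    also have "\<dots> \<le> \<delta> + \<delta> + \<delta> * 1"
      using a b \<delta> by (intro add_mono mult_mono) auto
    finally have "- (3 * \<delta>) \<le> Re (?a + ?b + ?a * ?b)"
      using abs_Re_le_cmod[of "?a + ?b + ?a * ?b"] by linarith
    moreover have "site_density z (n - 1) * site_density z n = 1 + (?a + ?b + ?a * ?b)"
      by (simp add: site_density_def algebra_simps)
    ultimately have "1 - 3 * \<delta> \<le> Re (site_density z (n - 1) * site_density z n)"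
      by simp
    moreover have "Re ((flux N \<gamma> z n)\<^sup>2) \<le> (\<Gamma> n + \<delta> * G)\<^sup>2"
    proof -
      have "Re ((flux N \<gamma> z n)\<^sup>2) \<le> (norm (flux N \<gamma> z n))\<^sup>2"
        using complex_Re_le_cmod[of "(flux N \<gamma> z n)\<^sup>2"] by (simp add: norm_power)
      also have "\<dots> \<le> (\<Gamma> n + \<delta> * G)\<^sup>2"
        using norm_flux_le[of N z, OF z n] by (intro power_mono) (auto simp: \<Gamma>_def G_def)
      finally show ?thesis .
    qed
    ultimately show "\<delta> \<le> Re (site_density z (n - 1) * site_density z n - (flux N \<gamma> z n)\<^sup>2)"
      using ev[OF n] by simp
  qed
qed

section \<open>The density map for a fixed choice of signs: bounds on the polydisc\<close>

locale sign_chain =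
  fixes N :: nat and \<gamma> \<sigma> :: "nat \<Rightarrow> real" and \<delta> :: real
  assumes N: "1 \<le> N"
    and \<sigma>: "\<And>n. \<sigma> n = 1 \<or> \<sigma> n = - 1"
    and \<delta>: "0 < \<delta>" "\<delta> < 1/2"
    and radicand: "\<And>z n. (\<And>m. m \<in> {1..N} \<Longrightarrow> norm (z m) \<le> \<delta>) \<Longrightarrow> n \<in> {1..N} \<Longrightarrow>
      \<delta> \<le> Re (site_density z (n - 1) * site_density z n - (flux N \<gamma> z n)\<^sup>2)"
begin

definition polydisc :: "(nat \<Rightarrow> complex) set" where
  "polydisc = {z. \<forall>m\<in>{1..N}. norm (z m) \<le> \<delta>}"

definition l1_dist :: "(nat \<Rightarrow> complex) \<Rightarrow> (nat \<Rightarrow> complex) \<Rightarrow> real" where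
  "l1_dist z z' = (\<Sum>m=1..N. norm (z m - z' m))"

lemma radicand_polydisc:
  "z \<in> polydisc \<Longrightarrow> n \<in> {1..N} \<Longrightarrow>
    \<delta> \<le> Re (site_density z (n - 1) * site_density z n - (flux N \<gamma> z n)\<^sup>2)"
  using radicand unfolding polydisc_def by simp

lemma Re_density_ge:
  assumes "z \<in> polydisc" "n \<le> N"
  shows "1/2 \<le> Re (site_density z n)"
proof -
  have "norm (z (max 1 n)) \<le> \<delta>"
    using assms N by (auto simp: polydisc_def)
  then show ?thesis
    using abs_Re_le_cmod[of "z (max 1 n)"] \<delta> unfolding site_density_def by simp
qed

lemma norm_density_ge: "z \<in> polydisc \<Longrightarrow> n \<le> N \<Longrightarrow> 1/2 \<le> norm (site_density z n)"
  using Re_density_ge complex_Re_le_cmod order_trans by blast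

lemma bounded_lipschitz_coord:
  assumes "m \<in> {1..N}"
  shows "bounded_lipschitz l1_dist polydisc (\<lambda>z. z m)"
proof (rule bounded_lipschitzI[where B=\<delta> and K=1])
  fix z z' :: "nat \<Rightarrow> complex"
  show "norm (z m - z' m) \<le> 1 * l1_dist z z'"
    unfolding l1_dist_def
    using assms member_le_sum[of m "{1..N}" "\<lambda>m. norm (z m - z' m)"] by simp
qed (use assms in \<open>simp add: polydisc_def\<close>)

lemma bounded_lipschitz_density:
  "n \<le> N \<Longrightarrow> bounded_lipschitz l1_dist polydisc (\<lambda>z. site_density z n)"
  unfolding site_density_def using N
  by (intro bounded_lipschitz_add bounded_lipschitz_const bounded_lipschitz_coord) auto

lemma bounded_lipschitz_flux:
  "1 \<le> n \<Longrightarrow> bounded_lipschitz l1_dist polydisc (\<lambda>z. flux N \<gamma> z n)"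
  unfolding flux_def
  by (intro bounded_lipschitz_sum bounded_lipschitz_mult bounded_lipschitz_add
      bounded_lipschitz_const bounded_lipschitz_coord) auto

lemma bounded_lipschitz_coupling:
  assumes "1 \<le> n"
  shows "bounded_lipschitz l1_dist polydisc (\<lambda>z. coupling N \<gamma> \<sigma> z n)"
proof (cases "n \<le> N")
  case True
  have "bounded_lipschitz l1_dist polydisc
      (\<lambda>z. site_density z (n - 1) * site_density z n + - (flux N \<gamma> z n * flux N \<gamma> z n))"
    using True assms
    by (intro bounded_lipschitz_add bounded_lipschitz_minus bounded_lipschitz_mult
        bounded_lipschitz_density bounded_lipschitz_flux) auto
  then have "bounded_lipschitz l1_dist polydisc
      (\<lambda>z. of_real (\<sigma> n) * csqrt (site_density z (n - 1) * site_density z n - (flux N \<gamma> z n)\<^sup>2))"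
    using True assms radicand_polydisc[of _ n] \<delta>
    by (intro bounded_lipschitz_mult bounded_lipschitz_const bounded_lipschitz_csqrt[of _ _ _ \<delta>])
      (auto simp: power2_eq_square)
  then show ?thesis using True by (simp add: coupling_def)
qed (simp add: coupling_def bounded_lipschitz_const)

lemma bounded_lipschitz_density_map:
  "n \<in> {1..N} \<Longrightarrow> bounded_lipschitz l1_dist polydisc (\<lambda>z. density_map N \<gamma> \<sigma> z n)"
  unfolding density_map_def
  using norm_density_ge[of _ n]
  by (intro bounded_lipschitz_mult bounded_lipschitz_minus bounded_lipschitz_add
      bounded_lipschitz_coupling bounded_lipschitz_density
      bounded_lipschitz_inverse[where c="1/2"]) auto

lemma density_map_bounds:
  obtains B K where "0 < B" "0 < K"
    and "\<And>z n. z \<in> polydisc \<Longrightarrow> n \<in> {1..N} \<Longrightarrow> norm (density_map N \<gamma> \<sigma> z n) \<le> B"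
    and "\<And>z z'. z \<in> polydisc \<Longrightarrow> z' \<in> polydisc \<Longrightarrow>
      (\<Sum>n=1..N. norm (density_map N \<gamma> \<sigma> z n - density_map N \<gamma> \<sigma> z' n)) \<le> K * l1_dist z z'"
proof -
  obtain b where b: "\<And>z n. n \<in> {1..N} \<Longrightarrow> z \<in> polydisc \<Longrightarrow> norm (density_map N \<gamma> \<sigma> z n) \<le> b n"
    using bounded_lipschitz_density_map unfolding bounded_lipschitz_def by metis
  obtain k where k: "\<And>z z' n. n \<in> {1..N} \<Longrightarrow> z \<in> polydisc \<Longrightarrow> z' \<in> polydisc \<Longrightarrow>
      norm (density_map N \<gamma> \<sigma> z n - density_map N \<gamma> \<sigma> z' n) \<le> k n * l1_dist z z'"
    using bounded_lipschitz_density_map unfolding bounded_lipschitz_def by metis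
  have d: "0 \<le> l1_dist z z'" for z z' unfolding l1_dist_def by (simp add: sum_nonneg)
  show thesis
  \<comment> \<open>Sums of absolute values, or the absolute value of a sum, give constants common
    to all sites; the added \<open>1\<close> makes them positive.\<close>
  proof (rule that[of "1 + (\<Sum>n=1..N. \<bar>b n\<bar>)" "1 + \<bar>\<Sum>n=1..N. k n\<bar>"])
    show "0 < 1 + (\<Sum>n=1..N. \<bar>b n\<bar>)"
      using sum_nonneg[of "{1..N}" "\<lambda>n. \<bar>b n\<bar>"] by linarith
    fix z z' :: "nat \<Rightarrow> complex"
    assume z: "z \<in> polydisc"
    show "norm (density_map N \<gamma> \<sigma> z n) \<le> 1 + (\<Sum>n=1..N. \<bar>b n\<bar>)" if "n \<in> {1..N}" for n
      using b[OF that z] member_le_sum[of n "{1..N}" "\<lambda>n. \<bar>b n\<bar>"] that by auto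
    assume z': "z' \<in> polydisc"
    have "(\<Sum>n=1..N. norm (density_map N \<gamma> \<sigma> z n - density_map N \<gamma> \<sigma> z' n))
        \<le> (\<Sum>n=1..N. k n * l1_dist z z')"
      using k z z' by (intro sum_mono) auto
    also have "\<dots> = (\<Sum>n=1..N. k n) * l1_dist z z'"
      by (simp add: sum_distrib_right)
    also have "\<dots> \<le> (1 + \<bar>\<Sum>n=1..N. k n\<bar>) * l1_dist z z'"
      using d by (intro mult_right_mono) auto
    finally show "(\<Sum>n=1..N. norm (density_map N \<gamma> \<sigma> z n - density_map N \<gamma> \<sigma> z' n))
        \<le> (1 + \<bar>\<Sum>n=1..N. k n\<bar>) * l1_dist z z'" .
  qed auto
qed

section \<open>Holomorphy in \<open>E\<close> of densities, links and amplitudes\<close>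

context
  fixes A :: "complex set" and z :: "nat \<Rightarrow> complex \<Rightarrow> complex"
  assumes hol: "\<And>m. m \<in> {1..N} \<Longrightarrow> z m holomorphic_on A"
    and disc: "\<And>E. E \<in> A \<Longrightarrow> (\<lambda>m. z m E) \<in> polydisc"
begin

lemma holomorphic_density: "n \<le> N \<Longrightarrow> (\<lambda>E. site_density (\<lambda>m. z m E) n) holomorphic_on A"
  unfolding site_density_def using N by (intro holomorphic_intros hol) auto

lemma holomorphic_flux: "1 \<le> n \<Longrightarrow> (\<lambda>E. flux N \<gamma> (\<lambda>m. z m E) n) holomorphic_on A"
  unfolding flux_def by (intro holomorphic_intros hol) auto

text \<open>The radicand has positive real part on the polydisc and so avoids the branch cut of
  \<open>csqrt\<close>.\<close>

lemma holomorphic_coupling: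
  assumes "1 \<le> n"
  shows "(\<lambda>E. coupling N \<gamma> \<sigma> (\<lambda>m. z m E) n) holomorphic_on A"
proof (cases "n \<le> N")
  case True
  then have "site_density (\<lambda>m. z m E) (n - 1) * site_density (\<lambda>m. z m E) n - (flux N \<gamma> (\<lambda>m. z m E) n)\<^sup>2 \<notin> \<real>\<^sub>\<le>\<^sub>0"
    if "E \<in> A" for E
    using radicand_polydisc[OF disc[OF that], of n] \<delta> assms
    by (auto simp: complex_nonpos_Reals_iff)
  then have "(\<lambda>E. of_real (\<sigma> n) * csqrt (site_density (\<lambda>m. z m E) (n - 1) * site_density (\<lambda>m. z m E) n
      - (flux N \<gamma> (\<lambda>m. z m E) n)\<^sup>2)) holomorphic_on A"
    using True assms by (intro holomorphic_intros holomorphic_density holomorphic_flux) auto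
  then show ?thesis using True by (simp add: coupling_def)
qed (simp add: coupling_def)

lemma holomorphic_link: "1 \<le> n \<Longrightarrow> (\<lambda>E. link N \<gamma> \<sigma> (\<lambda>m. z m E) n) holomorphic_on A"
  unfolding link_def by (intro holomorphic_intros holomorphic_coupling holomorphic_flux)

lemma density_nonzero: "E \<in> A \<Longrightarrow> n \<le> N \<Longrightarrow> site_density (\<lambda>m. z m E) n \<noteq> 0"
  using norm_density_ge[OF disc] by fastforce

lemma holomorphic_density_map:
  "n \<in> {1..N} \<Longrightarrow> (\<lambda>E. density_map N \<gamma> \<sigma> (\<lambda>m. z m E) n) holomorphic_on A"
  unfolding density_map_def using density_nonzero
  by (intro holomorphic_intros holomorphic_coupling holomorphic_density) auto

text \<open>Index \<open>k\<close> is the site \<open>k + 1\<close>. Only the first site involves a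
  square root, and \<open>first\<close> puts the link, or its negative, in the right half-plane;
  each later amplitude is a link times the previous one over a nonzero density.\<close>

lemma holomorphic_amplitude:
  assumes first: "\<And>E. E \<in> A \<Longrightarrow> 0 < \<sigma> 1 * Re (link N \<gamma> \<sigma> (\<lambda>m. z m E) 1)"
  shows "k < N \<Longrightarrow> (\<lambda>E. amplitude N \<gamma> \<sigma> (\<lambda>m. z m E) k) holomorphic_on A"
proof (induction k)
  case 0
  show ?case
  proof (cases "\<sigma> 1 = 1")
    case True
    then have "link N \<gamma> \<sigma> (\<lambda>m. z m E) 1 \<notin> \<real>\<^sub>\<le>\<^sub>0" if "E \<in> A" for E
      using first[OF that] by (auto simp: complex_nonpos_Reals_iff)
    then have "(\<lambda>E. csqrt (link N \<gamma> \<sigma> (\<lambda>m. z m E) 1)) holomorphic_on A"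
      by (intro holomorphic_intros holomorphic_link) auto
    then show ?thesis using True by simp
  next
    case False
    then have "- link N \<gamma> \<sigma> (\<lambda>m. z m E) 1 \<notin> \<real>\<^sub>\<le>\<^sub>0" if "E \<in> A" for E
      using first[OF that] \<sigma>[of 1] by (auto simp: complex_nonpos_Reals_iff)
    then have "(\<lambda>E. \<i> * csqrt (- link N \<gamma> \<sigma> (\<lambda>m. z m E) 1)) holomorphic_on A"
      by (intro holomorphic_intros holomorphic_link) auto
    then show ?thesis using False by simp
  qed
next
  case (Suc k)
  then have "(\<lambda>E. link N \<gamma> \<sigma> (\<lambda>m. z m E) (k + 2) * amplitude N \<gamma> \<sigma> (\<lambda>m. z m E) k
      / site_density (\<lambda>m. z m E) (k + 1)) holomorphic_on A"
    using density_nonzero by (intro holomorphic_intros holomorphic_link holomorphic_density) auto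
  then show ?case by simp
qed

end

section \<open>Real fixed points and the stationary solutions they yield\<close>

context
  fixes z :: "nat \<Rightarrow> complex"
  assumes disc: "z \<in> polydisc" and real: "\<And>m. m \<in> {1..N} \<Longrightarrow> z m \<in> \<real>"
begin

lemma density_real: "n \<le> N \<Longrightarrow> site_density z n = of_real (Re (site_density z n))"
  unfolding site_density_def using N real[of "max 1 n"] by (intro of_real_Re[symmetric] Reals_add) auto

lemma flux_real: "1 \<le> n \<Longrightarrow> flux N \<gamma> z n = of_real (Re (flux N \<gamma> z n))"
  unfolding flux_def
  by (intro of_real_Re[symmetric] sum_in_Reals Reals_mult Reals_add real) auto

lemma radicand_of_real:
  assumes "n \<in> {1..N}"
  shows "site_density z (n - 1) * site_density z n - (flux N \<gamma> z n)\<^sup>2 =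
    of_real (Re (site_density z (n - 1)) * Re (site_density z n) - (Re (flux N \<gamma> z n))\<^sup>2)"
proof -
  obtain a b f where "site_density z (n - 1) = of_real a" "site_density z n = of_real b" "flux N \<gamma> z n = of_real f"
    using that[OF density_real density_real flux_real] assms by auto
  then show ?thesis by simp
qed

lemma radicand_real:
  assumes "n \<in> {1..N}"
  shows "\<delta> \<le> Re (site_density z (n - 1)) * Re (site_density z n) - (Re (flux N \<gamma> z n))\<^sup>2"
  using radicand_polydisc[OF disc assms] unfolding radicand_of_real[OF assms] by simp

text \<open>A positive real radicand makes \<open>csqrt\<close> the positive real root, so the sign
  of the coupling is exactly \<open>\<sigma> n\<close>.\<close>

lemma coupling_real:
  assumes "n \<in> {1..N}"
  shows "coupling N \<gamma> \<sigma> z n = of_real (\<sigma> n *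
    sqrt (Re (site_density z (n - 1)) * Re (site_density z n) - (Re (flux N \<gamma> z n))\<^sup>2))"
proof -
  have "csqrt (site_density z (n - 1) * site_density z n - (flux N \<gamma> z n)\<^sup>2) =
    of_real (sqrt (Re (site_density z (n - 1)) * Re (site_density z n) - (Re (flux N \<gamma> z n))\<^sup>2))"
    unfolding radicand_of_real[OF assms]
    using radicand_real[OF assms] \<delta> by (intro csqrt_of_real) linarith
  then show ?thesis using assms by (simp add: coupling_def)
qed

end

text \<open>At a fixed point \<open>E * z n\<close>, the deviation of the density from
  \<open>E\<close>, equals \<open>density_map\<close>, so bounds on the latter do not depend on
  \<open>E\<close>. The sign conclusion tells branches apart; the last one keeps real
  \<open>E\<close> where the first amplitude is holomorphic.\<close>

lemma amplitude_solution:
  fixes z :: "nat \<Rightarrow> complex" and E :: real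
  assumes disc: "z \<in> polydisc" and real: "\<And>m. m \<in> {1..N} \<Longrightarrow> z m \<in> \<real>" and E: "E > 0"
    and fixpoint: "\<And>n. n \<in> {1..N} \<Longrightarrow> z n = density_map N \<gamma> \<sigma> z n / of_real E"
  defines "w \<equiv> \<lambda>n. of_real (sqrt E) *
    (if n = 0 then cnj (amplitude N \<gamma> \<sigma> z 0) else amplitude N \<gamma> \<sigma> z (n - 1))"
  shows "stationary_solution N \<gamma> E w"
    and "\<And>n. n \<in> {1..N} \<Longrightarrow> \<bar>(cmod (w n))\<^sup>2 - E\<bar> = norm (density_map N \<gamma> \<sigma> z n)"
    and "\<And>n. n \<in> {1..N} \<Longrightarrow> sgn (Re (cnj (w (n - 1)) * w n)) = \<sigma> n"
    and "0 < \<sigma> 1 * Re (link N \<gamma> \<sigma> z 1)"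
proof -
  define y where "y n = Re (site_density z n)" for n
  define j where "j n = Re (flux N \<gamma> z n)" for n
  define s where "s n = Re (coupling N \<gamma> \<sigma> z n)" for n
  define u where "u n = (if n = 0 then cnj (amplitude N \<gamma> \<sigma> z 0) else amplitude N \<gamma> \<sigma> z (n - 1))" for n
  have dens: "site_density z n = of_real (y n)" if "n \<le> N" for n
    unfolding y_def using density_real[OF disc real that] .
  have fl: "flux N \<gamma> z n = of_real (j n)" if "1 \<le> n" for n
    unfolding j_def using flux_real[OF disc real that] .
  have y: "y n > 0" if "n \<le> N" for n
    using Re_density_ge[OF disc that] unfolding y_def by linarith
  have rad: "0 < y (n - 1) * y n - (j n)\<^sup>2" if "n \<in> {1..N}" for n
    using radicand_real[OF disc real that] \<delta> unfolding y_def j_def by simp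
  have s_eq: "s n = \<sigma> n * sqrt (y (n - 1) * y n - (j n)\<^sup>2)" if "n \<in> {1..N}" for n
    using coupling_real[OF disc real that] unfolding s_def y_def j_def by simp
  have s_last: "s (N + 1) = 0" and coup_last: "coupling N \<gamma> \<sigma> z (N + 1) = 0"
    unfolding s_def by (simp_all add: coupling_def)
  have coup: "coupling N \<gamma> \<sigma> z n = of_real (s n)" if "n \<in> {1..N + 1}" for n
  proof (cases "n = N + 1")
    case False
    then have "n \<in> {1..N}" using that by auto
    then show ?thesis unfolding s_def using coupling_real[OF disc real] by simp
  qed (use s_last coup_last in simp)
  have lnk: "link N \<gamma> \<sigma> z n = Complex (s n) (j n)" if "n \<in> {1..N + 1}" for n
    unfolding link_def using coup[OF that] fl[of n] that by (simp add: complex_eq_iff)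
  have \<sigma>2: "(\<sigma> n)\<^sup>2 = 1" for n using \<sigma>[of n] by auto
  have link_norm: "(s n)\<^sup>2 + (j n)\<^sup>2 = y (n - 1) * y n" if "n \<in> {1..N}" for n
    unfolding s_eq[OF that] using rad[OF that] \<sigma>2 by (simp add: power_mult_distrib)
  have z_y: "z n = of_real (y n - 1)" if "n \<in> {1..N}" for n
    using dens[of n] that by (simp add: site_density_def max_def algebra_simps)
  have j_rec: "j n = j (n + 1) + \<gamma> n * y n" if "n \<in> {1..N}" for n
  proof -
    have "flux N \<gamma> z n = of_real (\<gamma> n) * (1 + z n) + flux N \<gamma> z (n + 1)"
      unfolding flux_def using that by (simp add: sum.atLeast_Suc_atMost)
    then have "complex_of_real (j n) = of_real (j (n + 1) + \<gamma> n * y n)"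
      using fl[of n] fl[of "n + 1"] that z_y[OF that] by (simp add: add.commute)
    then show ?thesis unfolding of_real_eq_iff .
  qed
  have s_rec: "E * (1 - y n) * y n = s (n + 1) + s n" if "n \<in> {1..N}" for n
  proof -
    \<comment> \<open>Multiplied by \<open>E * y n\<close>, the fixed point equation is the real
      part of the stationary equation.\<close>
    have "complex_of_real (y n - 1) = of_real (- (s (n + 1) + s n) * inverse (y n) / E)"
      using fixpoint[OF that] z_y[OF that] coup[of n] coup[of "n + 1"] dens[of n] that
      by (simp add: density_map_def)
    then have "y n - 1 = - (s (n + 1) + s n) * inverse (y n) / E"
      unfolding of_real_eq_iff .
    then have "(y n - 1) * (E * y n) = - (s (n + 1) + s n)"
      using E y[of n] that by (simp add: field_simps)
    then show ?thesis by (simp add: algebra_simps)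
  qed
  have u1: "(u 1)\<^sup>2 = Complex (s 1) (j 1)"
    using lnk[of 1] by (simp add: u_def power_mult_distrib)
  have u_rec: "u (n + 1) = Complex (s (n + 1)) (j (n + 1)) * u n / y n" if n: "n \<in> {1..N}" for n
  proof -
    obtain m where "n = Suc m" using n by (cases n) auto
    then show ?thesis
      using lnk[of "n + 1"] dens[of n] n by (simp add: u_def)
  qed
  \<comment> \<open>Two boundary conditions hold by construction: \<open>max 1 n\<close> identifies
    the densities at \<open>0\<close> and \<open>1\<close>, and the flux at \<open>N + 1\<close> is
    an empty sum.\<close>
  have y0: "y 0 = y 1" by (simp add: y_def site_density_def)
  have j_last: "j (N + 1) = 0" by (simp add: j_def flux_def)
  have w: "w = (\<lambda>n. of_real (sqrt E) * u n)"
    by (simp add: w_def u_def)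
  have u0: "u 0 = cnj (u 1)" by (simp add: u_def)
  have y_pos: "0 < y n" if "n \<in> {1..N}" for n using y that by simp
  note sol = stationary_solution_from_links[of E N y s j \<gamma> u, OF E N y_pos y0 link_norm s_last j_last
      j_rec s_rec u0 u1 u_rec]
  show "stationary_solution N \<gamma> E w"
    unfolding w by (rule sol(1))
  have norm_u: "(norm (u n))\<^sup>2 = y n" if "n \<in> {1..N}" for n
    using that by (rule sol(2)[rotated -1])
  have link_u: "cnj (u (n - 1)) * u n = Complex (s n) (j n)" if "n \<in> {1..N}" for n
    using that by (rule sol(3)[rotated -1])
  show "\<bar>(cmod (w n))\<^sup>2 - E\<bar> = norm (density_map N \<gamma> \<sigma> z n)" if n: "n \<in> {1..N}" for n
  proof -
    have "(cmod (w n))\<^sup>2 = E * y n"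
      unfolding w using norm_u[OF n] E by (simp add: norm_mult power_mult_distrib)
    then have "\<bar>(cmod (w n))\<^sup>2 - E\<bar> = \<bar>E * (y n - 1)\<bar>"
      by (simp add: algebra_simps)
    also have "\<dots> = norm (of_real E * z n)"
      unfolding z_y[OF n] by (simp only: norm_of_real flip: of_real_mult)
    also have "of_real E * z n = density_map N \<gamma> \<sigma> z n"
      using fixpoint[OF n] E by simp
    finally show ?thesis .
  qed
  have sgn_s: "sgn (s n) = \<sigma> n" if "n \<in> {1..N}" for n
    unfolding s_eq[OF that] using rad[OF that] \<sigma>[of n] by (auto simp: sgn_mult)
  show "sgn (Re (cnj (w (n - 1)) * w n)) = \<sigma> n" if n: "n \<in> {1..N}" for n
  proof -
    have "cnj (w (n - 1)) * w n = of_real (sqrt E * sqrt E) * (cnj (u (n - 1)) * u n)"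
      unfolding w by (simp only: complex_cnj_mult complex_cnj_complex_of_real of_real_mult mult_ac)
    also have "\<dots> = of_real E * Complex (s n) (j n)"
      using link_u[OF n] E by simp
    finally show ?thesis
      using sgn_s[OF n] E by (simp add: sgn_mult)
  qed
  show "0 < \<sigma> 1 * Re (link N \<gamma> \<sigma> z 1)"
    using lnk[of 1] s_eq[of 1] rad[of 1] N \<sigma>2[of 1]
    by (simp add: power2_eq_square flip: mult.assoc)
qed

section \<open>The smooth branch of solutions with prescribed signs\<close>

lemma solution_branch:
  obtains E0 C W where "0 < E0" "0 < C"
    and "\<And>n. n \<in> {1..N} \<Longrightarrow> smooth_on_open {E0<..} (\<lambda>E. W E n)"
    and "\<And>E. E > E0 \<Longrightarrow> stationary_solution N \<gamma> E (W E)"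
    and "\<And>E n. E > E0 \<Longrightarrow> n \<in> {1..N} \<Longrightarrow> \<bar>(cmod (W E n))\<^sup>2 - E\<bar> \<le> C"
    and "\<And>E n. E > E0 \<Longrightarrow> n \<in> {1..N} \<Longrightarrow> sgn (Re (cnj (W E (n - 1)) * W E n)) = \<sigma> n"
proof -
  obtain B K where B: "0 < B" and K: "0 < K"
    and bound: "\<And>z n. z \<in> polydisc \<Longrightarrow> n \<in> {1..N} \<Longrightarrow> norm (density_map N \<gamma> \<sigma> z n) \<le> B"
    and lip: "\<And>z z'. z \<in> polydisc \<Longrightarrow> z' \<in> polydisc \<Longrightarrow>
      (\<Sum>n=1..N. norm (density_map N \<gamma> \<sigma> z n - density_map N \<gamma> \<sigma> z' n)) \<le> K * l1_dist z z'"
    using density_map_bounds by blast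
  \<comment> \<open>The term \<open>B / \<delta>\<close> makes \<open>density_map / E\<close>
    preserve the polydisc; \<open>2 * K\<close> gives the contraction factor one half.\<close>
  define E0 where "E0 = B / \<delta> + 2 * K"
  have E0: "0 < E0" "B \<le> \<delta> * E0" "2 * K \<le> E0"
    using B K \<delta> by (simp_all add: E0_def add_pos_pos distrib_left)
  \<comment> \<open>On this half-plane \<open>norm E\<close> is at least \<open>E0\<close>, so the
    estimates hold as for real \<open>E\<close>, and the cut of \<open>csqrt\<close> is
    avoided.\<close>
  define A where "A = {E. E0 < Re E}"
  have A: "open A" unfolding A_def by (rule open_halfspace_Re_gt)
  have normA: "E0 \<le> norm E" if "E \<in> A" for E
    using that complex_Re_le_cmod[of E] unfolding A_def by simp
  have in_polydisc: "z \<in> polydisc" if "\<And>m. m \<in> {1..N} \<Longrightarrow> norm (z m) \<le> \<delta>" for z :: "nat \<Rightarrow> complex"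
    using that unfolding polydisc_def by simp
  obtain Z where Z_hol: "\<And>n. n \<in> {1..N} \<Longrightarrow> Z n holomorphic_on A"
    and Z_le: "\<And>n E. n \<in> {1..N} \<Longrightarrow> E \<in> A \<Longrightarrow> norm (Z n E) \<le> \<delta>"
    and Z_fix: "\<And>n E. n \<in> {1..N} \<Longrightarrow> E \<in> A \<Longrightarrow> Z n E = density_map N \<gamma> \<sigma> (\<lambda>m. Z m E) n / E"
    and Z_real: "\<And>n E. n \<in> {1..N} \<Longrightarrow> E \<in> A \<Longrightarrow> E \<in> \<real> \<Longrightarrow> Z n E \<in> \<real>"
  proof (rule holomorphic_contraction_fixpoint[of A "{1..N}" \<delta> "\<lambda>E z n. density_map N \<gamma> \<sigma> z n / E"])
    show "open A" by (rule A)
    show "0 \<le> \<delta>" using \<delta> by simp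
    fix E and z :: "nat \<Rightarrow> complex" and n
    assume E: "E \<in> A" and "\<And>m. m \<in> {1..N} \<Longrightarrow> norm (z m) \<le> \<delta>" and n: "n \<in> {1..N}"
    then have z: "z \<in> polydisc" using in_polydisc by blast
    have nE: "0 < norm E" "B \<le> \<delta> * norm E"
      using normA[OF E] E0 \<delta> mult_left_mono[of E0 "norm E" \<delta>] by linarith+
    show "norm (density_map N \<gamma> \<sigma> z n / E) \<le> \<delta>"
      using bound[OF z n] nE by (simp add: norm_divide divide_le_eq)
    assume "E \<in> \<real>" and real: "\<And>m. m \<in> {1..N} \<Longrightarrow> z m \<in> \<real>"
    have "site_density z n \<in> \<real>"
      using density_real[OF z real, of n] n by (metis Reals_of_real atLeastAtMost_iff)
    moreover have "coupling N \<gamma> \<sigma> z k \<in> \<real>" if "1 \<le> k" for k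
      using coupling_real[OF z real, of k] that
      by (cases "k \<le> N") (auto simp del: of_real_mult, simp add: coupling_def)
    ultimately show "density_map N \<gamma> \<sigma> z n / E \<in> \<real>"
      unfolding density_map_def using \<open>E \<in> \<real>\<close> n
      by (intro Reals_divide Reals_mult Reals_minus Reals_add Reals_inverse) auto
  next
    fix E and z z' :: "nat \<Rightarrow> complex"
    assume E: "E \<in> A" and "\<And>m. m \<in> {1..N} \<Longrightarrow> norm (z m) \<le> \<delta>" "\<And>m. m \<in> {1..N} \<Longrightarrow> norm (z' m) \<le> \<delta>"
    then have z: "z \<in> polydisc" "z' \<in> polydisc" using in_polydisc by blast+
    have nE: "0 < norm E" "2 * K \<le> norm E"
      using normA[OF E] E0 by auto
    have d: "0 \<le> l1_dist z z'" unfolding l1_dist_def by (simp add: sum_nonneg)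
    have "(\<Sum>n=1..N. norm (density_map N \<gamma> \<sigma> z n / E - density_map N \<gamma> \<sigma> z' n / E))
        = (\<Sum>n=1..N. norm (density_map N \<gamma> \<sigma> z n - density_map N \<gamma> \<sigma> z' n)) / norm E"
      by (simp add: sum_divide_distrib norm_divide flip: diff_divide_distrib)
    also have "\<dots> \<le> K * l1_dist z z' / norm E"
      using lip[OF z] nE by (intro divide_right_mono) auto
    also have "\<dots> \<le> 1/2 * l1_dist z z'"
      using nE mult_right_mono[OF nE(2) d] by (simp add: field_simps)
    finally show "(\<Sum>n=1..N. norm (density_map N \<gamma> \<sigma> z n / E - density_map N \<gamma> \<sigma> z' n / E))
        \<le> 1/2 * (\<Sum>n=1..N. norm (z n - z' n))"
      unfolding l1_dist_def .
  next
    fix z :: "nat \<Rightarrow> complex \<Rightarrow> complex" and n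
    assume hol: "\<And>m. m \<in> {1..N} \<Longrightarrow> z m holomorphic_on A" and n: "n \<in> {1..N}"
      and le: "\<And>m E. m \<in> {1..N} \<Longrightarrow> E \<in> A \<Longrightarrow> norm (z m E) \<le> \<delta>"
    have "(\<lambda>m. z m E) \<in> polydisc" if "E \<in> A" for E
      by (intro in_polydisc le that)
    then show "(\<lambda>E. density_map N \<gamma> \<sigma> (\<lambda>m. z m E) n / E) holomorphic_on A"
      using holomorphic_density_map[of z A n] hol n normA E0
      by (intro holomorphic_intros) force+
  qed auto
  have Z_disc: "(\<lambda>m. Z m E) \<in> polydisc" if "E \<in> A" for E
    by (intro in_polydisc Z_le that)
  have realA: "of_real E \<in> A" if "E > E0" for E
    using that by (simp add: A_def)
  define W where "W E n = of_real (sqrt E) * (if n = 0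
    then cnj (amplitude N \<gamma> \<sigma> (\<lambda>m. Z m (of_real E)) 0)
    else amplitude N \<gamma> \<sigma> (\<lambda>m. Z m (of_real E)) (n - 1))" for E n
  have pos: "E > 0" if "E > E0" for E using E0 that by simp
  note sol = amplitude_solution[OF Z_disc[OF realA] Z_real[OF _ realA Reals_of_real] pos
      Z_fix[OF _ realA], folded W_def]
  \<comment> \<open>For complex \<open>E\<close> the first link may meet the branch cut, so shrink the half-plane.\<close>
  define A' where "A' = A \<inter> (\<lambda>E. \<sigma> 1 * Re (link N \<gamma> \<sigma> (\<lambda>m. Z m E) 1)) -` {0<..}"
  have A': "open A'"
    unfolding A'_def
    using holomorphic_on_imp_continuous_on[OF holomorphic_link[OF Z_hol Z_disc, of 1]] A
    by (intro continuous_open_preimage continuous_intros) auto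
  have smooth: "smooth_on_open {E0<..} (\<lambda>E. W E n)" if n: "n \<in> {1..N}" for n
  proof (rule smooth_on_open_holomorphic)
    \<comment> \<open>The factor \<open>sqrt E\<close> of \<open>W\<close> extends holomorphically
      as \<open>csqrt\<close>.\<close>
    have "csqrt holomorphic_on A'"
      using E0 by (intro holomorphic_on_csqrt' holomorphic_on_ident)
        (auto simp: A'_def A_def complex_nonpos_Reals_iff)
    moreover have "(\<lambda>E. amplitude N \<gamma> \<sigma> (\<lambda>m. Z m E) (n - 1)) holomorphic_on A'"
      using holomorphic_on_subset[OF Z_hol, of _ A'] Z_disc n
      by (intro holomorphic_amplitude) (auto simp: A'_def)
    ultimately show "(\<lambda>E. csqrt E * amplitude N \<gamma> \<sigma> (\<lambda>m. Z m E) (n - 1)) holomorphic_on A'"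
      by (rule holomorphic_on_mult)
  next
    fix E assume "E \<in> {E0<..}"
    then have E: "E > E0" by simp
    \<comment> \<open>For real \<open>E\<close> the first link has real part of sign
      \<open>\<sigma> 1\<close>, so shrinking \<open>A\<close> loses no point of the ray.\<close>
    show "of_real E \<in> A'"
      using realA[OF E] sol(4)[OF E] E unfolding A'_def by simp
    show "W E n = csqrt (of_real E) * amplitude N \<gamma> \<sigma> (\<lambda>m. Z m (of_real E)) (n - 1)"
      using n pos[OF E] by (simp add: W_def csqrt_of_real)
  qed (use A' in auto)
  show thesis
  proof (rule that[OF E0(1) B smooth])
    fix E assume E: "E > E0"
    show "stationary_solution N \<gamma> E (W E)"
      using sol(1) E by simp
    fix n assume n: "n \<in> {1..N}"
    show "\<bar>(cmod (W E n))\<^sup>2 - E\<bar> \<le> B"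
      using sol(2) E n bound[OF Z_disc[OF realA[OF E]] n] by simp
    show "sgn (Re (cnj (W E (n - 1)) * W E n)) = \<sigma> n"
      using sol(3) E n by simp
  qed
qed

end

section \<open>Counting solutions by signs\<close>

text \<open>The lowest \<open>N\<close> bits of an index will serve as its sign pattern, and they
  determine any number below \<open>2 ^ N\<close>.\<close>

lemma bit_differs_below:
  fixes j k :: nat
  assumes "j < 2 ^ N" "k < 2 ^ N" "j \<noteq> k"
  obtains m where "m < N" "bit j m \<noteq> bit k m"
proof -
  have "take_bit N j \<noteq> take_bit N k"
    using assms by (simp add: take_bit_nat_eq_self)
  then show thesis
    using that by (auto simp: bit_eq_iff bit_take_bit_iff)
qed

text \<open>A common sign cancels in the product. For \<open>n = 1\<close> the predecessor is site
  \<open>0\<close>, outside the range of \<open>gauge_equivalent\<close>; the boundary condition of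
  the two solutions transfers the sign to it.\<close>

lemma gauge_equivalent_link:
  assumes "gauge_equivalent N v w" "stationary_solution N \<gamma> E v" "stationary_solution N \<gamma> E w"
    and n: "n \<in> {1..N}"
  shows "cnj (v (n - 1)) * v n = cnj (w (n - 1)) * w n"
proof -
  have "v 0 = cnj (v 1)" "w 0 = cnj (w 1)"
    using assms(2,3) by (auto simp: stationary_solution_def)
  moreover have "1 \<in> {1..N}" using n by simp
  moreover have "n - 1 = 0 \<or> n - 1 \<in> {1..N}" using n by auto
  ultimately consider "v n = w n" "v (n - 1) = w (n - 1)" | "v n = - w n" "v (n - 1) = - w (n - 1)"
    using assms(1) n unfolding gauge_equivalent_def by (metis complex_cnj_minus)
  then show ?thesis by cases simp_all
qed

theorem theorem4p1:
  fixes N :: nat and \<gamma> :: "nat \<Rightarrow> real"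
  assumes "\<forall>K\<in>{1..N}. \<bar>\<Sum>n=K..N. \<gamma> n\<bar> < 1"
  shows "\<exists>E0 > 0. \<exists>C > 0. \<exists>W :: nat \<Rightarrow> real \<Rightarrow> nat \<Rightarrow> complex.
    (\<forall>j < 2 ^ N.
       (\<forall>n\<in>{1..N}. smooth_on_open {E0<..} (\<lambda>E. W j E n)) \<and>
       (\<forall>E > E0. stationary_solution N \<gamma> E (W j E) \<and>
                 (\<forall>n\<in>{1..N}. \<bar>(cmod (W j E n))\<^sup>2 - E\<bar> \<le> C))) \<and>
    (\<forall>j < 2 ^ N. \<forall>k < 2 ^ N. j \<noteq> k \<longrightarrow>
       (\<forall>E > E0. \<not> gauge_equivalent N (W j E) (W k E)))"
proof (cases "N = 0")
  case True
  \<comment> \<open>There is a single index \<open>j = 0\<close>, so the zero vector suffices and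
    distinctness is vacuous.\<close>
  then show ?thesis
    by (intro exI[of _ 1] conjI exI[of _ "\<lambda>_ _ _. 0"]) (auto simp: stationary_solution_def)
next
  case False
  obtain \<delta> where \<delta>: "0 < \<delta>" "\<delta> < 1/2"
    and radicand: "\<And>z n. (\<And>m. m \<in> {1..N} \<Longrightarrow> norm (z m) \<le> \<delta>) \<Longrightarrow> n \<in> {1..N} \<Longrightarrow>
      \<delta> \<le> Re (site_density z (n - 1) * site_density z n - (flux N \<gamma> z n)\<^sup>2)"
    using radicand_bound[OF assms] by blast
  \<comment> \<open>Sites \<open>1..N\<close> read the bits \<open>0..N - 1\<close>.\<close>
  define \<sigma> :: "nat \<Rightarrow> nat \<Rightarrow> real" where "\<sigma> j n = (if bit j (n - 1) then 1 else - 1)" for j n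
  have "sign_chain N \<gamma> (\<sigma> j) \<delta>" for j
    using False \<delta> radicand by unfold_locales (auto simp: \<sigma>_def)
  then have "\<exists>E0 C W. 0 < E0 \<and> 0 < C \<and> (\<forall>n\<in>{1..N}. smooth_on_open {E0<..} (\<lambda>E. W E n)) \<and>
      (\<forall>E>E0. stationary_solution N \<gamma> E (W E) \<and>
        (\<forall>n\<in>{1..N}. \<bar>(cmod (W E n))\<^sup>2 - E\<bar> \<le> C \<and> sgn (Re (cnj (W E (n - 1)) * W E n)) = \<sigma> j n))" for j
    using sign_chain.solution_branch[of N \<gamma> "\<sigma> j" \<delta>] by metis
  then obtain E0 C W where E0: "\<And>j. 0 < E0 j" and C: "\<And>j. 0 < C j"
    and smooth: "\<And>j n. n \<in> {1..N} \<Longrightarrow> smooth_on_open {E0 j<..} (\<lambda>E. W j E n)"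
    and sol: "\<And>j E. E > E0 j \<Longrightarrow> stationary_solution N \<gamma> E (W j E)"
    and bound: "\<And>j E n. E > E0 j \<Longrightarrow> n \<in> {1..N} \<Longrightarrow> \<bar>(cmod (W j E n))\<^sup>2 - E\<bar> \<le> C j"
    and sign: "\<And>j E n. E > E0 j \<Longrightarrow> n \<in> {1..N} \<Longrightarrow> sgn (Re (cnj (W j E (n - 1)) * W j E n)) = \<sigma> j n"
    by metis
  \<comment> \<open>A sum of positive constants dominates each of them, and it is positive because
    the index range is nonempty.\<close>
  define E1 where "E1 = (\<Sum>j<2^N. E0 j)"
  define C1 where "C1 = (\<Sum>j<2^N. C j)"
  have le: "E0 j \<le> E1" "C j \<le> C1" if "j < 2 ^ N" for j
    unfolding E1_def C1_def
    using that E0 C by (auto intro!: member_le_sum simp: less_imp_le)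
  have pos: "0 < E1" "0 < C1"
    unfolding E1_def C1_def using E0 C by (auto simp: lessThan_empty_iff intro!: sum_pos)
  have distinct: "\<not> gauge_equivalent N (W j E) (W k E)"
    if jk: "j < 2 ^ N" "k < 2 ^ N" "j \<noteq> k" and E: "E > E1" for j k E
  proof
    assume eq: "gauge_equivalent N (W j E) (W k E)"
    obtain m where m: "m < N" "bit j m \<noteq> bit k m"
      using bit_differs_below[OF jk] .
    then have n: "m + 1 \<in> {1..N}" by simp
    have Ejk: "E > E0 j" "E > E0 k"
      using le(1)[OF jk(1)] le(1)[OF jk(2)] E by auto
    have "\<sigma> j (m + 1) = \<sigma> k (m + 1)"
      using sign[OF Ejk(1) n] sign[OF Ejk(2) n]
        gauge_equivalent_link[OF eq sol[OF Ejk(1)] sol[OF Ejk(2)] n] by metis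
    then show False using m by (auto simp: \<sigma>_def split: if_splits)
  qed
  show ?thesis
  proof (rule exI[of _ E1], rule conjI[OF pos(1)], rule exI[of _ C1], rule conjI[OF pos(2)],
      intro exI[of _ W] conjI allI impI ballI distinct)
    fix j :: nat assume j: "j < 2 ^ N"
    show "smooth_on_open {E1<..} (\<lambda>E. W j E n)" if "n \<in> {1..N}" for n
      using le(1)[OF j] by (intro smooth_on_open_subset[OF smooth[OF that, of j]]) auto
    fix E assume "E1 < E"
    then have E: "E0 j < E" using le(1)[OF j] by simp
    show "stationary_solution N \<gamma> E (W j E)" using sol[OF E] .
    show "\<bar>(cmod (W j E n))\<^sup>2 - E\<bar> \<le> C1" if "n \<in> {1..N}" for n
      using bound[OF E that] le(2)[OF j] by simp
  qed
qed

end
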